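(* If $X$ is a polygonal $\mathbb{Z}^2$-subshift with coding polygon $\mathcal{P}$ and $\Psi:X\to Y$ is a recoding, then $Y$ is a polygonal subshift with coding polygon $n\mathcal{P}$ for some integer $n>0$.
   Context: For a finite alphabet $\mathcal{A}$ (discrete topology), a $\mathbb{Z}^2$-subshift is a closed subset $X\subset\mathcal{A}^{\mathbb{Z}^2}$ (product topology) invariant under the shifts $(T^ux)(v)=x(u+v)$, $u\in\mathbb{Z}^2$. For $A,B\subset\mathbb{R}^2$, $A$ $X$-codes $B$ if whenever $x,x'\in X$ agree on $A\cap\mathbb{Z}^2$ they agree on $B\cap\mathbb{Z}^2$. A map $\Psi:X\to Y$ between $\mathbb{Z}^2$-subshifts (possibly over different finite alphabets) is a recoding if it is a homeomorphism commuting with the shift actions and there is a finite set $F\subset\mathbb{Z}^2$ such that for all $(i,j)\in\mathbb{Z}^2$ and $x,x'\in X$: $\Psi(x)(i,j)=\Psi(x')(i,j)$ if and only if $x$ and $x'$ agree on $F+(i,j)$. An integer polygon is a polygon in $\mathbb{R}^2$ (including its interior) with all vertices in $\mathbb{Z}^2$; $n\mathcal{P}=\{nx: x\in\mathcal{P}\}$. A convex integer polygon $\mathcal{P}$ is a coding polygon for an infinite $\mathbb{Z}^2$-subshift $X$ if for every vertex $v$ of $\mathcal{P}$, $\mathcal{P}\setminus\{v\}$ $X$-codes $\{v\}$. $X$ is polygonal if it is infinite and has a coding polygon. *)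

theory Defs
  imports "HOL-Analysis.Analysis"
begin

type_synonym 'a config = "int \<times> int \<Rightarrow> 'a"

(* The topological space of all configurations over the discrete alphabet A. *)
definition config_space :: "'a set \<Rightarrow> 'a config topology" where
  "config_space A = product_topology (\<lambda>_. discrete_topology A) UNIV"

definition shift :: "int \<times> int \<Rightarrow> 'a config \<Rightarrow> 'a config" where
  "shift u x = (\<lambda>v. x (u + v))"

definition subshift :: "'a set \<Rightarrow> 'a config set \<Rightarrow> bool" where
  "subshift A X \<longleftrightarrow> finite A \<and> closedin (config_space A) X \<and> (\<forall>u. shift u ` X = X)"

definition lattice_point :: "int \<times> int \<Rightarrow> real \<times> real" where
  "lattice_point u = (real_of_int (fst u), real_of_int (snd u))"

definition agree_on :: "(int \<times> int) set \<Rightarrow> 'a config \<Rightarrow> 'a config \<Rightarrow> bool" where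
  "agree_on S x x' \<longleftrightarrow> (\<forall>u\<in>S. x u = x' u)"

definition codes :: "'a config set \<Rightarrow> (real \<times> real) set \<Rightarrow> (real \<times> real) set \<Rightarrow> bool" where
  "codes X S T \<longleftrightarrow>
     (\<forall>x\<in>X. \<forall>x'\<in>X. agree_on (lattice_point -` S) x x' \<longrightarrow> agree_on (lattice_point -` T) x x')"

(* Psi is only constrained on X; outside X its values are irrelevant. *)
definition recoding ::
  "'a set \<Rightarrow> 'a config set \<Rightarrow> 'b set \<Rightarrow> 'b config set \<Rightarrow> ('a config \<Rightarrow> 'b config) \<Rightarrow> bool" where
  "recoding A X B Y \<Psi> \<longleftrightarrow>
     subshift A X \<and> subshift B Y \<and>
     homeomorphic_map (subtopology (config_space A) X) (subtopology (config_space B) Y) \<Psi> \<and>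
     (\<forall>u. \<forall>x\<in>X. \<Psi> (shift u x) = shift u (\<Psi> x)) \<and>
     (\<exists>F. finite F \<and>
        (\<forall>u. \<forall>x\<in>X. \<forall>x'\<in>X. \<Psi> x u = \<Psi> x' u \<longleftrightarrow> agree_on ((\<lambda>f. f + u) ` F) x x'))"

(* A polygon is a region with nonempty interior: points and segments are not polygons.
   The vertices of a convex polygon are its extreme points. *)
definition convex_integer_polygon :: "(real \<times> real) set \<Rightarrow> bool" where
  "convex_integer_polygon P \<longleftrightarrow>
     polytope P \<and> interior P \<noteq> {} \<and> (\<forall>v. v extreme_point_of P \<longrightarrow> v \<in> range lattice_point)"

definition coding_polygon :: "'a set \<Rightarrow> 'a config set \<Rightarrow> (real \<times> real) set \<Rightarrow> bool" where
  "coding_polygon A X P \<longleftrightarrow>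
     subshift A X \<and> infinite X \<and> convex_integer_polygon P \<and>
     (\<forall>v. v extreme_point_of P \<longrightarrow> codes X (P - {v}) {v})"

definition polygonal :: "'a set \<Rightarrow> 'a config set \<Rightarrow> bool" where
  "polygonal A X \<longleftrightarrow> subshift A X \<and> infinite X \<and> (\<exists>P. coding_polygon A X P)"

end

theory Submission
  imports Defs
begin

text \<open>
  The factor \<open>n = 1\<close> already works, because a coding relation survives a recoding unchanged
  (\<open>recoding_preserves_codes\<close>). Let \<open>F\<close> be the window of the recoding \<open>\<Psi>\<close>, so that \<open>\<Psi> x\<close> and
  \<open>\<Psi> x'\<close> agree at \<open>u\<close> exactly when \<open>x\<close> and \<open>x'\<close> agree on \<open>F + u\<close>. If \<open>\<Psi> x\<close> and \<open>\<Psi> x'\<close> agree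
  on a set \<open>S\<close>, then \<open>x\<close> and \<open>x'\<close> agree on \<open>F + S\<close>, which is the union of the translates \<open>f + S\<close>
  for \<open>f \<in> F\<close>. Now suppose that \<open>S\<close> codes \<open>T\<close> in \<open>X\<close>. By shift invariance \<open>f + S\<close> codes \<open>f + T\<close>,
  so \<open>x\<close> and \<open>x'\<close> agree on \<open>F + T\<close>, and the converse direction of the window property gives
  agreement of \<open>\<Psi> x\<close> and \<open>\<Psi> x'\<close> on \<open>T\<close>.

  For a coding polygon this is applied with \<open>S = P - {v}\<close> and \<open>T = {v}\<close> at every vertex \<open>v\<close>. The
  subshift \<open>Y\<close> is infinite since \<open>\<Psi>\<close> is a bijection from \<open>X\<close> onto \<open>Y\<close>.
\<close>

lemma shift_mem_subshift:
  assumes "subshift A X" and "x \<in> X"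
  shows "shift u x \<in> X"
  using assms unfolding subshift_def by blast

lemma topspace_subshift:
  assumes "subshift A X"
  shows "topspace (subtopology (config_space A) X) = X"
  using assms unfolding subshift_def
  by (metis closedin_subset topspace_subtopology_subset)

lemma recoding_bij_betw:
  assumes "recoding A X B Y \<Psi>"
  shows "bij_betw \<Psi> X Y"
proof -
  have "subshift A X" "subshift B Y"
    and "homeomorphic_map (subtopology (config_space A) X) (subtopology (config_space B) Y) \<Psi>"
    using assms unfolding recoding_def by auto
  then show ?thesis
    by (metis bij_betw_def homeomorphic_eq_everything_map
        topspace_subshift)
qed

text \<open>
  The window moves along with the point at which the image is read, so for each fixed element \<open>f\<close>
  of the window, agreement of the images on \<open>S\<close> implies that the originals shifted by \<open>f\<close> agree on
  the same set \<open>S\<close>. The given coding relation can therefore be used once for each \<open>f\<close>, without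
  enlarging \<open>S\<close>.
\<close>

lemma recoding_preserves_codes:
  assumes rec: "recoding A X B Y \<Psi>" and codes: "codes X S T"
  shows "codes Y S T"
  unfolding codes_def
proof (intro ballI impI)
  fix y y'
  assume "y \<in> Y" "y' \<in> Y" and agree: "agree_on (lattice_point -` S) y y'"
  then obtain x x' where x: "x \<in> X" "y = \<Psi> x" and x': "x' \<in> X" "y' = \<Psi> x'"
    using recoding_bij_betw[OF rec] unfolding bij_betw_def by blast
  have X: "subshift A X"
    using rec unfolding recoding_def by blast
  obtain F where "\<And>u x x'. x \<in> X \<Longrightarrow> x' \<in> X \<Longrightarrow>
      \<Psi> x u = \<Psi> x' u \<longleftrightarrow> agree_on ((\<lambda>f. f + u) ` F) x x'"
    using rec unfolding recoding_def by metis
  then have window: "y u = y' u \<longleftrightarrow> (\<forall>f\<in>F. x (f + u) = x' (f + u))" for u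
    using x x' unfolding agree_on_def by blast
  have "x (f + u) = x' (f + u)" if f: "f \<in> F" and u: "u \<in> lattice_point -` T" for f u
  proof -
    have "agree_on (lattice_point -` S) (shift f x) (shift f x')"
      using agree window f unfolding agree_on_def shift_def by blast
    then have "agree_on (lattice_point -` T) (shift f x) (shift f x')"
      using codes shift_mem_subshift[OF X] x(1) x'(1) unfolding codes_def by blast
    then show ?thesis
      using u unfolding agree_on_def shift_def by blast
  qed
  then show "agree_on (lattice_point -` T) y y'"
    using window unfolding agree_on_def by blast
qed

lemma recoding_preserves_coding_polygon:
  assumes rec: "recoding A X B Y \<Psi>" and P: "coding_polygon A X P"
  shows "coding_polygon B Y P"
proof -
  have "infinite Y"
    using P bij_betw_finite[OF recoding_bij_betw[OF rec]] unfolding coding_polygon_def by blast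
  moreover have "subshift B Y"
    using rec unfolding recoding_def by blast
  ultimately show ?thesis
    using P recoding_preserves_codes[OF rec] unfolding coding_polygon_def by blast
qed

theorem corollary5p5:
  fixes A :: "'a set" and B :: "'b set"
    and X :: "'a config set" and Y :: "'b config set"
    and P :: "(real \<times> real) set"
    and \<Psi> :: "'a config \<Rightarrow> 'b config"
  assumes "polygonal A X"
    and "coding_polygon A X P"
    and "recoding A X B Y \<Psi>"
  shows "polygonal B Y \<and> (\<exists>n::int. n > 0 \<and> coding_polygon B Y ((\<lambda>p. real_of_int n *\<^sub>R p) ` P))"
proof -
  have P: "coding_polygon B Y P"
    using recoding_preserves_coding_polygon assms(2,3) by blast
  then have "polygonal B Y"
    unfolding polygonal_def coding_polygon_def by blast
  moreover have "coding_polygon B Y ((\<lambda>p. real_of_int 1 *\<^sub>R p) ` P)"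
    using P by simp
  ultimately show ?thesis
    using zero_less_one by blast
qed

end
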